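(* Let $\mathbb{K}$ be an algebraically closed field, let $q\in\mathbb{K}^*$ with $q^2\neq 1$, and let $\alpha,\beta,\gamma\in\mathbb{K}$. Then $A(\alpha,\beta,\gamma)$ is a polynomial identity (PI) algebra if and only if $q^2$ is a root of unity.
   Context: For $\alpha,\beta,\gamma\in\mathbb{K}$ and $q\in\mathbb{K}^*$, the 3-cyclic quantum Weyl algebra $A(\alpha,\beta,\gamma)$ is the associative unital $\mathbb{K}$-algebra generated by $x,y,z$ subject to the relations $xy=q^2yx+\alpha$, $xz=q^{-2}zx+\beta$, $yz=q^2zy+\gamma$. A ring $R$ is a polynomial identity (PI) ring if there is a monic polynomial $f\in\mathbb{Z}\langle x_1,\ldots,x_k\rangle$ in noncommuting variables (monic: some monomial of highest degree occurring in $f$ has coefficient $1$) with $f(r_1,\ldots,r_k)=0$ for all $r_i\in R$; a PI algebra is an algebra that is a PI ring. *)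

theory Defs
  imports
    "HOL-Library.Poly_Mapping"
    "HOL-Algebra.QuotRing"
    "HOL-Algebra.Algebraic_Closure_Type"
begin

section \<open>Free algebras\<close>

text \<open>
  The free monoid, written additively because the product of \<^typ>\<open>'a \<Rightarrow>\<^sub>0 'b\<close> is convolution
  with respect to \<open>+\<close> on \<^typ>\<open>'a\<close>.  It is wrapped in a datatype of its own so that it does not
  clash with the pointwise addition of lists.
\<close>

datatype 'x free_mon = Word (letters: "'x list")

instantiation free_mon :: (type) monoid_add
begin

definition zero_free_mon :: "'x free_mon"
  where "zero_free_mon = Word []"

definition plus_free_mon :: "'x free_mon \<Rightarrow> 'x free_mon \<Rightarrow> 'x free_mon"
  where "plus_free_mon u v = Word (letters u @ letters v)"

instance
  by standard (simp_all add: zero_free_mon_def plus_free_mon_def)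

end

type_synonym ('x, 'a) free_algebra = "'x free_mon \<Rightarrow>\<^sub>0 'a"

definition gen :: "'x \<Rightarrow> ('x, 'a::ring_1) free_algebra"
  where "gen x = Poly_Mapping.single (Word [x]) 1"

definition scal :: "'a::ring_1 \<Rightarrow> ('x, 'a) free_algebra"
  where "scal c = Poly_Mapping.single 0 c"

lemma ring_of_type_algebra_ring: "ring (ring_of_type_algebra :: 'a::ring_1 ring)"
proof -
  have "\<exists>y. y + x = 0 \<and> x + y = 0" for x :: 'a
    by (rule exI[of _ "- x"]) simp
  then show ?thesis
    unfolding ring_of_type_algebra_def
    by unfold_locales (auto simp: algebra_simps Units_def)
qed

section \<open>Polynomial identity rings\<close>

definition nc_eval :: "('r, 'm) ring_scheme \<Rightarrow> (nat \<Rightarrow> 'r) \<Rightarrow> (nat, int) free_algebra \<Rightarrow> 'r"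
  where "nc_eval R r f =
    (\<Oplus>\<^bsub>R\<^esub>w \<in> Poly_Mapping.keys f.
       [Poly_Mapping.lookup f w] \<cdot>\<^bsub>R\<^esub> foldr (\<lambda>i a. r i \<otimes>\<^bsub>R\<^esub> a) (letters w) \<one>\<^bsub>R\<^esub>)"

definition nc_monic :: "('x, int) free_algebra \<Rightarrow> bool"
  where "nc_monic f \<longleftrightarrow>
    (\<exists>w \<in> Poly_Mapping.keys f. Poly_Mapping.lookup f w = 1 \<and>
       (\<forall>v \<in> Poly_Mapping.keys f. length (letters v) \<le> length (letters w)))"

text \<open>The polynomial \<open>f\<close> lies in the free ring on the \<open>k\<close> variables with indices below \<open>k\<close>.\<close>

definition PI_ring :: "('r, 'm) ring_scheme \<Rightarrow> bool"
  where "PI_ring R \<longleftrightarrow>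
    (\<exists>(k::nat) f :: (nat, int) free_algebra.
       (\<forall>w \<in> Poly_Mapping.keys f. set (letters w) \<subseteq> {..<k}) \<and> nc_monic f \<and>
       (\<forall>r. (\<forall>i<k. r i \<in> carrier R) \<longrightarrow> nc_eval R r f = \<zero>\<^bsub>R\<^esub>))"

section \<open>The 3-cyclic quantum Weyl algebra\<close>

datatype xyz = Gx | Gy | Gz

definition cyclic_weyl_rels :: "'k::field \<Rightarrow> 'k \<Rightarrow> 'k \<Rightarrow> 'k \<Rightarrow> (xyz, 'k) free_algebra set"
  where "cyclic_weyl_rels q \<alpha> \<beta> \<gamma> =
    {gen Gx * gen Gy - (scal (q\<^sup>2) * gen Gy * gen Gx + scal \<alpha>),
     gen Gx * gen Gz - (scal (inverse (q\<^sup>2)) * gen Gz * gen Gx + scal \<beta>),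
     gen Gy * gen Gz - (scal (q\<^sup>2) * gen Gz * gen Gy + scal \<gamma>)}"

definition cyclic_weyl_ideal :: "'k::field \<Rightarrow> 'k \<Rightarrow> 'k \<Rightarrow> 'k \<Rightarrow> (xyz, 'k) free_algebra set"
  where "cyclic_weyl_ideal q \<alpha> \<beta> \<gamma> = Idl\<^bsub>ring_of_type_algebra\<^esub> (cyclic_weyl_rels q \<alpha> \<beta> \<gamma>)"

text \<open>
  Only the ring underlying the algebra is recorded, which is what the notion of a PI algebra
  refers to.  The ideal is generated in the free \<open>K\<close>-algebra, which contains the scalars, so it is
  also the ideal generated as an algebra; scalar multiplication on the quotient is multiplication
  by the (central) classes of \<^term>\<open>scal c\<close>.
\<close>

definition cyclic_weyl ::
    "'k::field \<Rightarrow> 'k \<Rightarrow> 'k \<Rightarrow> 'k \<Rightarrow> (xyz, 'k) free_algebra set ring"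
  where "cyclic_weyl q \<alpha> \<beta> \<gamma> = ring_of_type_algebra Quot (cyclic_weyl_ideal q \<alpha> \<beta> \<gamma>)"

definition cyclic_weyl_class ::
    "'k::field \<Rightarrow> 'k \<Rightarrow> 'k \<Rightarrow> 'k \<Rightarrow> (xyz, 'k) free_algebra \<Rightarrow> (xyz, 'k) free_algebra set"
  where "cyclic_weyl_class q \<alpha> \<beta> \<gamma> a = cyclic_weyl_ideal q \<alpha> \<beta> \<gamma> +>\<^bsub>ring_of_type_algebra\<^esub> a"

lemma ring_of_type_algebra_simps:
  "carrier ring_of_type_algebra = UNIV"
  "x \<otimes>\<^bsub>ring_of_type_algebra\<^esub> y = x * y"
  "x \<oplus>\<^bsub>ring_of_type_algebra\<^esub> y = x + y"
  "\<one>\<^bsub>ring_of_type_algebra\<^esub> = 1"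
  "\<zero>\<^bsub>ring_of_type_algebra\<^esub> = 0"
  by (simp_all add: ring_of_type_algebra_def)

lemma ideal_cyclic_weyl_ideal: "ideal (cyclic_weyl_ideal q \<alpha> \<beta> \<gamma>) ring_of_type_algebra"
  unfolding cyclic_weyl_ideal_def
  by (rule ring.genideal_ideal[OF ring_of_type_algebra_ring]) (simp add: ring_of_type_algebra_simps)

lemma ring_cyclic_weyl: "ring (cyclic_weyl q \<alpha> \<beta> \<gamma>)"
  unfolding cyclic_weyl_def by (rule ideal.quotient_is_ring[OF ideal_cyclic_weyl_ideal])

lemma cyclic_weyl_class_hom:
  "cyclic_weyl_class q \<alpha> \<beta> \<gamma> \<in> ring_hom ring_of_type_algebra (cyclic_weyl q \<alpha> \<beta> \<gamma>)"
  using ideal.rcos_ring_hom[OF ideal_cyclic_weyl_ideal, of q \<alpha> \<beta> \<gamma>]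
  by (simp add: cyclic_weyl_def cyclic_weyl_class_def[abs_def])

lemma cyclic_weyl_class_eqI:
  assumes "a - b \<in> cyclic_weyl_rels q \<alpha> \<beta> \<gamma>"
  shows "cyclic_weyl_class q \<alpha> \<beta> \<gamma> a = cyclic_weyl_class q \<alpha> \<beta> \<gamma> b"
proof -
  let ?F = "ring_of_type_algebra :: (xyz, 'a) free_algebra ring"
  interpret F: ring ?F by (rule ring_of_type_algebra_ring)
  interpret I: ideal "cyclic_weyl_ideal q \<alpha> \<beta> \<gamma>" ?F by (rule ideal_cyclic_weyl_ideal)
  have "a - b \<in> cyclic_weyl_ideal q \<alpha> \<beta> \<gamma>"
    using F.genideal_self[of "cyclic_weyl_rels q \<alpha> \<beta> \<gamma>"] assms
    by (auto simp: ring_of_type_algebra_simps cyclic_weyl_ideal_def)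
  then have "a \<in> cyclic_weyl_class q \<alpha> \<beta> \<gamma> b"
    unfolding cyclic_weyl_class_def a_r_coset_def r_coset_def
    by (auto simp: ring_of_type_algebra_simps intro!: bexI[of _ "a - b"])
  then show ?thesis
    unfolding cyclic_weyl_class_def
    by (metis I.a_repr_independence' ring_of_type_algebra_simps(1) UNIV_I)
qed

lemma cyclic_weyl_relations:
  fixes q \<alpha> \<beta> \<gamma> :: "'k::field"
  defines "cl \<equiv> cyclic_weyl_class q \<alpha> \<beta> \<gamma>" and "A \<equiv> cyclic_weyl q \<alpha> \<beta> \<gamma>"
  shows "cl (gen Gx) \<otimes>\<^bsub>A\<^esub> cl (gen Gy) = cl (scal (q\<^sup>2)) \<otimes>\<^bsub>A\<^esub> cl (gen Gy) \<otimes>\<^bsub>A\<^esub> cl (gen Gx) \<oplus>\<^bsub>A\<^esub> cl (scal \<alpha>)"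
    and "cl (gen Gx) \<otimes>\<^bsub>A\<^esub> cl (gen Gz) = cl (scal (inverse (q\<^sup>2))) \<otimes>\<^bsub>A\<^esub> cl (gen Gz) \<otimes>\<^bsub>A\<^esub> cl (gen Gx) \<oplus>\<^bsub>A\<^esub> cl (scal \<beta>)"
    and "cl (gen Gy) \<otimes>\<^bsub>A\<^esub> cl (gen Gz) = cl (scal (q\<^sup>2)) \<otimes>\<^bsub>A\<^esub> cl (gen Gz) \<otimes>\<^bsub>A\<^esub> cl (gen Gy) \<oplus>\<^bsub>A\<^esub> cl (scal \<gamma>)"
proof -
  have m: "cl a \<otimes>\<^bsub>A\<^esub> cl b = cl (a * b)" and p: "cl a \<oplus>\<^bsub>A\<^esub> cl b = cl (a + b)" for a b
    using ring_hom_mult[OF cyclic_weyl_class_hom, of a b q \<alpha> \<beta> \<gamma>]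
      ring_hom_add[OF cyclic_weyl_class_hom, of a b q \<alpha> \<beta> \<gamma>]
    by (simp_all add: cl_def A_def ring_of_type_algebra_simps)
  show "cl (gen Gx) \<otimes>\<^bsub>A\<^esub> cl (gen Gy) = cl (scal (q\<^sup>2)) \<otimes>\<^bsub>A\<^esub> cl (gen Gy) \<otimes>\<^bsub>A\<^esub> cl (gen Gx) \<oplus>\<^bsub>A\<^esub> cl (scal \<alpha>)"
    "cl (gen Gx) \<otimes>\<^bsub>A\<^esub> cl (gen Gz) = cl (scal (inverse (q\<^sup>2))) \<otimes>\<^bsub>A\<^esub> cl (gen Gz) \<otimes>\<^bsub>A\<^esub> cl (gen Gx) \<oplus>\<^bsub>A\<^esub> cl (scal \<beta>)"
    "cl (gen Gy) \<otimes>\<^bsub>A\<^esub> cl (gen Gz) = cl (scal (q\<^sup>2)) \<otimes>\<^bsub>A\<^esub> cl (gen Gz) \<otimes>\<^bsub>A\<^esub> cl (gen Gy) \<oplus>\<^bsub>A\<^esub> cl (scal \<gamma>)"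
    unfolding m p unfolding cl_def
    by (rule cyclic_weyl_class_eqI; simp add: cyclic_weyl_rels_def)+
qed

lemma scal_mult_single:
  "scal c * Poly_Mapping.single w a = Poly_Mapping.single w (c * a)"
  "Poly_Mapping.single w a * scal c = Poly_Mapping.single w (a * c)"
  by (simp_all add: scal_def mult_single)

lemma scal_central: "scal (c :: 'k::comm_ring_1) * a = a * scal c"
proof (induction a rule: Poly_Mapping.update_induct)
  case (update f w b)
  then have "Poly_Mapping.update w b f = f + Poly_Mapping.single w b"
    by (intro poly_mapping_eqI)
       (auto simp: lookup_update lookup_add lookup_single when_def in_keys_iff)
  then show ?case
    using update by (simp add: algebra_simps scal_mult_single mult.commute)
qed simp

end

theory Submission
  imports Defs "HOL-Combinatorics.Permutations"
begin

text \<open>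
  Put \<open>p = q\<^sup>2\<close>.  If \<open>p ^ n = 1\<close> and \<open>p \<noteq> 1\<close>, then \<open>1 + p + \<dots> + p ^ (n - 1) = 0\<close>, so \<open>x ^ n\<close>, \<open>y ^ n\<close>
  and \<open>z ^ n\<close> are central and the \<open>n ^ 3\<close> monomials \<open>z ^ a * y ^ b * x ^ c\<close> with exponents below
  \<open>n\<close> span the algebra over its centre; a standard polynomial in more than \<open>n ^ 3\<close> variables,
  being multilinear and alternating, vanishes identically.

  If \<open>p\<close> is not a root of unity, the algebra has a representation on which \<open>y\<close> acts as a shift and \<open>z\<close>
  as a triangular operator with the pairwise distinct diagonal entries \<open>p ^ n\<close>.  Lagrange interpolation
  in \<open>z\<close> yields elements that behave like matrix units on leading coefficients.  Substituting suitable
  sums of these into a monic polynomial isolates the coefficient of any chosen word of maximal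
  length, so no multilinearisation is needed to see that the polynomial is not an identity.
\<close>

section \<open>Evaluating identities in a quotient ring\<close>

text \<open>Ideals of a type-class ring, so that computations modulo the ideal use ordinary ring
  arithmetic instead of carriers; \<open>ideal_type_algebra_iff\<close> links the two views.\<close>

locale two_sided_ideal =
  fixes I :: "'a::ring_1 set"
  assumes zero_mem: "0 \<in> I"
    and add_mem: "a \<in> I \<Longrightarrow> b \<in> I \<Longrightarrow> a + b \<in> I"
    and mult_mem: "a \<in> I \<Longrightarrow> r * a \<in> I" "a \<in> I \<Longrightarrow> a * r \<in> I"
begin

lemma uminus_mem: "a \<in> I \<Longrightarrow> - a \<in> I"
  using mult_mem(1)[of a "- 1"] by simp

lemma sum_mem: "(\<And>i. i \<in> S \<Longrightarrow> f i \<in> I) \<Longrightarrow> sum f S \<in> I"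
  by (induction S rule: infinite_finite_induct) (auto intro: zero_mem add_mem)

end

lemma ideal_type_algebra_iff:
  "ideal I (ring_of_type_algebra :: 'a::ring_1 ring) \<longleftrightarrow> two_sided_ideal I"
proof
  let ?R = "ring_of_type_algebra :: 'a ring"
  assume "ideal I ?R"
  then interpret ideal I ?R .
  show "two_sided_ideal I"
    using additive_subgroup.zero_closed[OF is_additive_subgroup]
      additive_subgroup.a_closed[OF is_additive_subgroup] I_l_closed I_r_closed
    by unfold_locales (auto simp: ring_of_type_algebra_simps)
next
  let ?R = "ring_of_type_algebra :: 'a ring"
  assume "two_sided_ideal I"
  then interpret two_sided_ideal I .
  interpret R: ring ?R by (rule ring_of_type_algebra_ring)
  have minus: "\<ominus>\<^bsub>?R\<^esub> a = - a" for a
    by (rule R.minus_equality) (auto simp: ring_of_type_algebra_simps)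
  show "ideal I ?R"
  proof (rule idealI[OF ring_of_type_algebra_ring])
    show "subgroup I (add_monoid ?R)"
    proof (rule R.add.subgroupI)
      show "I \<noteq> {}" using zero_mem by blast
      show "\<ominus>\<^bsub>?R\<^esub> a \<in> I" if "a \<in> I" for a
        using that uminus_mem by (simp add: minus)
    qed (auto simp: ring_of_type_algebra_simps add_mem)
  qed (auto simp: ring_of_type_algebra_simps mult_mem)
qed

definition word_eval :: "(nat \<Rightarrow> 'a::ring_1) \<Rightarrow> (nat, int) free_algebra \<Rightarrow> 'a"
  where "word_eval r f =
    (\<Sum>w\<in>Poly_Mapping.keys f. of_int (Poly_Mapping.lookup f w) * prod_list (map r (letters w)))"

lemma finsum_type_algebra:
  "finite S \<Longrightarrow> (\<Oplus>\<^bsub>ring_of_type_algebra\<^esub>i\<in>S. f i :: 'a::ring_1) = sum f S"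
proof -
  interpret R: ring "ring_of_type_algebra :: 'a ring" by (rule ring_of_type_algebra_ring)
  show "finite S \<Longrightarrow> ?thesis"
    by (induction S rule: finite_induct) (auto simp: R.finsum_insert ring_of_type_algebra_simps)
qed

lemma (in ring_hom_ring) hom_add_pow_nat:
  assumes "a \<in> carrier R"
  shows "h ([(k::nat)] \<cdot>\<^bsub>R\<^esub> a) = [k] \<cdot>\<^bsub>S\<^esub> h a"
  using assms by (induction k) simp_all

lemma (in ring_hom_ring) hom_add_pow_int:
  assumes "a \<in> carrier R"
  shows "h ([(k::int)] \<cdot>\<^bsub>R\<^esub> a) = [k] \<cdot>\<^bsub>S\<^esub> h a"
  using assms
  by (cases "k \<ge> 0") (simp_all add: add_pow_int_ge add_pow_int_lt hom_add_pow_nat)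

lemma add_pow_nat_type_algebra: "[(k::nat)] \<cdot>\<^bsub>ring_of_type_algebra\<^esub> (a::'a::ring_1) = of_nat k * a"
proof -
  interpret R: ring "ring_of_type_algebra :: 'a ring" by (rule ring_of_type_algebra_ring)
  show ?thesis
    by (induction k) (auto simp: ring_of_type_algebra_simps algebra_simps)
qed

lemma add_pow_int_type_algebra: "[(k::int)] \<cdot>\<^bsub>ring_of_type_algebra\<^esub> (a::'a::ring_1) = of_int k * a"
proof -
  interpret R: ring "ring_of_type_algebra :: 'a ring" by (rule ring_of_type_algebra_ring)
  have minus: "\<ominus>\<^bsub>ring_of_type_algebra\<^esub> b = - b" for b :: 'a
    by (rule R.minus_equality) (auto simp: ring_of_type_algebra_simps)
  show ?thesis
    by (cases "k \<ge> 0")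
       (simp_all add: add_pow_int_ge add_pow_int_lt add_pow_nat_type_algebra minus of_nat_nat)
qed

text \<open>Homomorphisms commute with evaluation. Agreement of the two assignments is asked only on
  letters occurring in \<open>f\<close>, because \<open>PI_ring\<close> leaves the variables with
  index at least \<open>k\<close> unconstrained.\<close>

lemma nc_eval_hom:
  assumes "ring_hom_ring ring_of_type_algebra S h"
    and r: "\<And>w i. w \<in> Poly_Mapping.keys f \<Longrightarrow> i \<in> set (letters w) \<Longrightarrow> r' i = h (r i)"
  shows "nc_eval S r' f = h (word_eval r f)"
proof -
  let ?R = "ring_of_type_algebra"
  interpret ring_hom_ring ?R S h by fact
  have word: "foldr (\<lambda>i a. r' i \<otimes>\<^bsub>S\<^esub> a) xs \<one>\<^bsub>S\<^esub> = h (prod_list (map r xs))"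
    if "\<And>i. i \<in> set xs \<Longrightarrow> r' i = h (r i)" for xs
    using that
    by (induction xs)
       (auto simp: hom_mult[symmetric, simplified ring_of_type_algebra_simps]
         hom_one[simplified ring_of_type_algebra_simps])
  let ?g = "\<lambda>w. of_int (Poly_Mapping.lookup f w) * prod_list (map r (letters w))"
  have scale: "[k] \<cdot>\<^bsub>S\<^esub> h a = h (of_int k * a)" for k :: int and a
    by (subst hom_add_pow_int[symmetric])
       (auto simp: ring_of_type_algebra_simps add_pow_int_type_algebra)
  have "nc_eval S r' f = (\<Oplus>\<^bsub>S\<^esub>w\<in>Poly_Mapping.keys f. h (?g w))"
    unfolding nc_eval_def
  proof (rule S.finsum_cong')
    show "[Poly_Mapping.lookup f w] \<cdot>\<^bsub>S\<^esub> foldr (\<lambda>i a. r' i \<otimes>\<^bsub>S\<^esub> a) (letters w) \<one>\<^bsub>S\<^esub> = h (?g w)"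
      if "w \<in> Poly_Mapping.keys f" for w
      by (subst word) (auto intro: r that simp: scale)
  qed (auto simp: ring_of_type_algebra_simps)
  also have "\<dots> = h (\<Oplus>\<^bsub>?R\<^esub>w\<in>Poly_Mapping.keys f. ?g w)"
    by (subst hom_finsum) (auto simp: ring_of_type_algebra_simps comp_def)
  finally show ?thesis
    by (simp add: finsum_type_algebra word_eval_def)
qed

text \<open>Every element of the quotient is a coset, so assignments lift to the ring, and a value
  is zero in the quotient exactly when its lift lies in \<open>I\<close>.\<close>

lemma PI_ring_quotient_iff:
  assumes "two_sided_ideal (I :: 'a::ring_1 set)"
  shows "PI_ring (ring_of_type_algebra Quot I) \<longleftrightarrow>
    (\<exists>(k::nat) f. (\<forall>w\<in>Poly_Mapping.keys f. set (letters w) \<subseteq> {..<k}) \<and> nc_monic f \<and>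
      (\<forall>r. word_eval r f \<in> I))"
proof -
  let ?R = "ring_of_type_algebra :: 'a ring"
  let ?A = "?R Quot I"
  have id: "ideal I ?R" using assms by (simp add: ideal_type_algebra_iff)
  interpret ideal I ?R by (rule id)
  define h where "h = (+>\<^bsub>?R\<^esub>) I"
  have hom: "ring_hom_ring ?R ?A h"
    unfolding h_def by (rule rcos_ring_hom_ring)
  have zero: "h a = \<zero>\<^bsub>?A\<^esub> \<longleftrightarrow> a \<in> I" for a
    unfolding h_def
    by (metis FactRing_def UNIV_I a_rcos_const id rcos_const_imp_mem ring_of_type_algebra_simps(1)
        ring_record_simps(11))
  have carrier: "\<exists>a. c = h a" if "c \<in> carrier ?A" for c
    using that unfolding h_def FactRing_def A_RCOSETS_def' by auto
  have "(\<forall>r. (\<forall>i<k. r i \<in> carrier ?A) \<longrightarrow> nc_eval ?A r f = \<zero>\<^bsub>?A\<^esub>) \<longleftrightarrow> (\<forall>r. word_eval r f \<in> I)"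
    if vars: "\<forall>w\<in>Poly_Mapping.keys f. set (letters w) \<subseteq> {..<k}" for k f
  proof (intro iffI allI impI)
    fix r :: "nat \<Rightarrow> 'a"
    assume *: "\<forall>r. (\<forall>i<k. r i \<in> carrier ?A) \<longrightarrow> nc_eval ?A r f = \<zero>\<^bsub>?A\<^esub>"
    have "h (r i) \<in> carrier ?A" for i
      using ring_hom_ring.homh[OF hom] unfolding ring_hom_def
      by (auto simp: ring_of_type_algebra_simps)
    with * have "nc_eval ?A (\<lambda>i. h (r i)) f = \<zero>\<^bsub>?A\<^esub>" by simp
    then show "word_eval r f \<in> I" by (simp add: nc_eval_hom[OF hom, of f _ r] zero)
  next
    fix r
    assume *: "\<forall>r. word_eval r f \<in> I" and r: "\<forall>i<k. r i \<in> carrier ?A"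
    \<comment> \<open>If \<open>i\<close> is at least \<open>k\<close>, then \<open>r i\<close> may
      lie outside the carrier and the choice is arbitrary; such letters do not occur in
      \<open>f\<close>.\<close>
    define r' where "r' i = (SOME a. r i = h a)" for i
    have r': "r i = h (r' i)" if "i < k" for i
      unfolding r'_def by (rule someI_ex, rule carrier) (use r that in blast)
    have "nc_eval ?A r f = h (word_eval r' f)"
      by (rule nc_eval_hom[OF hom r']) (use vars in blast)
    also have "\<dots> = \<zero>\<^bsub>?A\<^esub>"
      using * by (simp add: zero)
    finally show "nc_eval ?A r f = \<zero>\<^bsub>?A\<^esub>" .
  qed
  then show ?thesis unfolding PI_ring_def by blast
qed

section \<open>The standard identity\<close>

definition std_eval :: "nat \<Rightarrow> (nat \<Rightarrow> 'a::ring_1) \<Rightarrow> 'a"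
  where "std_eval m r =
    (\<Sum>\<sigma> | \<sigma> permutes {..<m}. of_int (sign \<sigma>) * prod_list (map (\<lambda>j. r (\<sigma> j)) [0..<m]))"

definition std_poly :: "nat \<Rightarrow> (nat, int) free_algebra"
  where "std_poly m =
    (\<Sum>\<sigma> | \<sigma> permutes {..<m}. Poly_Mapping.single (Word (map \<sigma> [0..<m])) (sign \<sigma>))"

text \<open>Guarantees that the terms of the standard polynomial do not merge, so that its
  coefficients are the signs.\<close>

lemma inj_on_perm_word: "inj_on (\<lambda>\<sigma>. Word (map \<sigma> [0..<m])) {\<sigma>. \<sigma> permutes {..<m}}"
proof (rule inj_onI, clarsimp)
  fix \<sigma> \<tau> assume *: "\<sigma> permutes {..<m}" "\<tau> permutes {..<m}" "\<forall>i\<in>{0..<m}. \<sigma> i = \<tau> i"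
  then show "\<sigma> = \<tau>"
    by (intro ext, rename_tac i, case_tac "i < m") (auto simp: permutes_def)
qed

lemma lookup_std_poly:
  assumes "\<sigma> permutes {..<m}"
  shows "Poly_Mapping.lookup (std_poly m) (Word (map \<sigma> [0..<m])) = sign \<sigma>"
proof -
  have "Poly_Mapping.lookup (std_poly m) (Word (map \<sigma> [0..<m])) =
      (\<Sum>\<tau> | \<tau> permutes {..<m}. if \<tau> = \<sigma> then sign \<tau> else 0)"
    unfolding std_poly_def lookup_sum lookup_single
    using assms inj_on_perm_word[of m] by (intro sum.cong) (auto simp: when_def inj_on_def)
  also have "\<dots> = sign \<sigma>" using assms by (simp add: finite_permutations)
  finally show ?thesis .
qed

lemma keys_std_poly:
  "Poly_Mapping.keys (std_poly m) = (\<lambda>\<sigma>. Word (map \<sigma> [0..<m])) ` {\<sigma>. \<sigma> permutes {..<m}}"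
proof
  show "Poly_Mapping.keys (std_poly m) \<subseteq> (\<lambda>\<sigma>. Word (map \<sigma> [0..<m])) ` {\<sigma>. \<sigma> permutes {..<m}}"
    unfolding std_poly_def using keys_sum by fastforce
qed (auto simp: in_keys_iff lookup_std_poly sign_def)

lemma word_eval_std_poly: "word_eval r (std_poly m) = std_eval m r"
  unfolding word_eval_def keys_std_poly
  by (subst sum.reindex[OF inj_on_perm_word]) (simp add: std_eval_def lookup_std_poly comp_def)

lemma nc_monic_std_poly: "nc_monic (std_poly m)"
  unfolding nc_monic_def
proof (rule bexI[of _ "Word (map id [0..<m])"])
  show "Word (map id [0..<m]) \<in> Poly_Mapping.keys (std_poly m)"
    unfolding keys_std_poly using permutes_id by blast
  show "Poly_Mapping.lookup (std_poly m) (Word (map id [0..<m])) = 1 \<and>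
      (\<forall>v\<in>Poly_Mapping.keys (std_poly m). length (letters v) \<le> length (letters (Word (map id [0..<m]))))"
    by (subst lookup_std_poly) (auto simp: keys_std_poly permutes_id)
qed

lemma std_poly_letters: "w \<in> Poly_Mapping.keys (std_poly m) \<Longrightarrow> set (letters w) \<subseteq> {..<m}"
  using permutes_in_image[of _ "{..<m}"] by (fastforce simp: keys_std_poly)

text \<open>
  Even and odd permutations are paired off by composing with a transposition, rather than
  comparing the sum with its negative, so that characteristic 2 is covered.
\<close>

lemma std_eval_repeated:
  assumes "i < m" "j < m" "i \<noteq> j" "r i = r j"
  shows "std_eval m r = 0"
proof -
  let ?P = "{\<sigma>. \<sigma> permutes {..<m}}"
  let ?t = "transpose i j"
  let ?f = "\<lambda>\<sigma>. prod_list (map (\<lambda>j. r (\<sigma> j)) [0..<m])"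
  have t: "?t permutes {..<m}" using assms by (intro permutes_swap_id) auto
  have perm: "permutation \<sigma>" if "\<sigma> permutes {..<m}" for \<sigma>
    using that by (rule permutes_imp_permutation[rotated]) simp
  have even_t: "evenperm (?t \<circ> \<sigma>) \<longleftrightarrow> \<not> evenperm \<sigma>" if "\<sigma> permutes {..<m}" for \<sigma>
    using perm[OF that] perm[OF t] \<open>i \<noteq> j\<close> by (simp add: evenperm_comp evenperm_swap)
  have f_t: "?f (?t \<circ> \<sigma>) = ?f \<sigma>" for \<sigma>
    using \<open>r i = r j\<close> by (intro arg_cong[of _ _ prod_list] map_cong) (auto simp: transpose_def)
  have "(\<Sum>\<sigma>\<in>{\<sigma>\<in>?P. \<not> evenperm \<sigma>}. ?f \<sigma>) = (\<Sum>\<sigma>\<in>{\<sigma>\<in>?P. evenperm \<sigma>}. ?f \<sigma>)"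
    by (rule sum.reindex_bij_witness[of _ "\<lambda>\<sigma>. ?t \<circ> \<sigma>" "\<lambda>\<sigma>. ?t \<circ> \<sigma>"])
       (use t in \<open>auto simp: even_t f_t permutes_compose simp flip: comp_assoc simp del: comp_apply\<close>)
  moreover have "std_eval m r = (\<Sum>\<sigma>\<in>{\<sigma>\<in>?P. evenperm \<sigma>}. ?f \<sigma>) - (\<Sum>\<sigma>\<in>{\<sigma>\<in>?P. \<not> evenperm \<sigma>}. ?f \<sigma>)"
  proof -
    have "std_eval m r = (\<Sum>\<sigma>\<in>?P. if evenperm \<sigma> then ?f \<sigma> else - ?f \<sigma>)"
      unfolding std_eval_def by (intro sum.cong) (auto simp: sign_def)
    then show ?thesis
      by (simp add: sum.If_cases finite_permutations sum_negf Int_def)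
  qed
  ultimately show ?thesis by simp
qed

text \<open>Linearity in variable \<open>i\<close>: it occurs exactly once in each permutation word,
  so every term splits at that place, with \<open>L\<close> and \<open>R\<close> independent of
  \<open>a\<close>.\<close>

lemma std_eval_slot:
  fixes r :: "nat \<Rightarrow> 'a::ring_1"
  assumes "i < m"
  obtains L R where "\<And>a. std_eval m (r(i := a)) = (\<Sum>\<sigma> | \<sigma> permutes {..<m}. L \<sigma> * a * R \<sigma>)"
proof -
  \<comment> \<open>\<open>inv_into UNIV \<sigma> i\<close> is the position of variable
    \<open>i\<close> in the word.\<close>
  define L where "L \<sigma> = of_int (sign \<sigma>) * prod_list (map (\<lambda>j. r (\<sigma> j)) [0..<inv_into UNIV \<sigma> i])" for \<sigma>
  define R where "R \<sigma> = prod_list (map (\<lambda>j. r (\<sigma> j)) [Suc (inv_into UNIV \<sigma> i)..<m])" for \<sigma>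
  have "of_int (sign \<sigma>) * prod_list (map (\<lambda>j. (r(i := a)) (\<sigma> j)) [0..<m]) = L \<sigma> * a * R \<sigma>"
    if s: "\<sigma> permutes {..<m}" for \<sigma> a
  proof -
    define j where "j = inv_into UNIV \<sigma> i"
    have j: "j < m" "\<sigma> j = i"
      using permutes_in_image[OF permutes_inv[OF s], of i] assms permutes_inverses(1)[OF s]
      by (auto simp: j_def)
    have off: "\<sigma> k \<noteq> i" if "k \<noteq> j" for k
      using that permutes_inverses(2)[OF s] unfolding j_def by metis
    have "[0..<m] = [0..<j] @ j # [Suc j..<m]"
      using j by (metis less_imp_le upt_add_eq_append upt_conv_Cons le0 add_0 le_add_diff_inverse)
    then have "prod_list (map (\<lambda>j. (r(i := a)) (\<sigma> j)) [0..<m]) =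
      prod_list (map (\<lambda>j. (r(i := a)) (\<sigma> j)) [0..<j]) * a *
      prod_list (map (\<lambda>j. (r(i := a)) (\<sigma> j)) [Suc j..<m])"
      using j by (simp add: mult.assoc)
    moreover have "map (\<lambda>j. (r(i := a)) (\<sigma> j)) [0..<j] = map (\<lambda>j. r (\<sigma> j)) [0..<j]"
      "map (\<lambda>j. (r(i := a)) (\<sigma> j)) [Suc j..<m] = map (\<lambda>j. r (\<sigma> j)) [Suc j..<m]"
      using off by auto
    ultimately show ?thesis by (simp only: L_def R_def j_def mult.assoc)
  qed
  then show ?thesis by (intro that[of L R]) (simp add: std_eval_def)
qed

section \<open>Rings that are finite over their centre\<close>

context two_sided_ideal
begin

abbreviation eqv (infix \<open>\<approx>\<close> 50) where "a \<approx> b \<equiv> a - b \<in> I"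

lemma eqv_refl: "a \<approx> a"
  by (simp add: zero_mem)

lemma eqv_sym: "a \<approx> b \<Longrightarrow> b \<approx> a"
  using uminus_mem[of "a - b"] by simp

lemma eqv_trans [trans]: "a \<approx> b \<Longrightarrow> b \<approx> c \<Longrightarrow> a \<approx> c"
  using add_mem[of "a - b" "b - c"] by simp

lemma eqv_add: "a \<approx> b \<Longrightarrow> c \<approx> d \<Longrightarrow> a + c \<approx> b + d"
  using add_mem[of "a - b" "c - d"] by (simp add: algebra_simps)

lemma eqv_mult_left: "a \<approx> b \<Longrightarrow> c * a \<approx> c * b"
  using mult_mem(1)[of "a - b" c] by (simp add: algebra_simps)

lemma eqv_mult_right: "a \<approx> b \<Longrightarrow> a * c \<approx> b * c"
  using mult_mem(2)[of "a - b" c] by (simp add: algebra_simps)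

lemma eqv_mem: "a \<approx> b \<Longrightarrow> b \<in> I \<Longrightarrow> a \<in> I"
  using add_mem[of "a - b" b] by simp

definition central :: "'a \<Rightarrow> bool"
  where "central c \<longleftrightarrow> (\<forall>a. c * a \<approx> a * c)"

lemma centralD: "central c \<Longrightarrow> c * a \<approx> a * c"
  by (simp add: central_def)

lemma central_mult:
  assumes "central c" "central d"
  shows "central (c * d)"
  unfolding central_def
proof
  fix a
  have "c * d * a \<approx> c * (a * d)"
    using eqv_mult_left[OF centralD[OF assms(2)], of c a] by (simp add: mult.assoc)
  also have "c * (a * d) \<approx> a * c * d"
    using eqv_mult_right[OF centralD[OF assms(1)], of a d] by (simp add: mult.assoc)
  finally show "c * d * a \<approx> a * (c * d)" by (simp add: mult.assoc)
qed

lemma central_power: "central c \<Longrightarrow> central (c ^ k)"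
  by (induction k) (auto simp: central_mult, simp add: central_def zero_mem)

text \<open>The span of \<open>B\<close> over the centre of the quotient, pulled back to the ring.
  The inductive form allows arguments to be expanded without writing out linear
  combinations.\<close>

inductive_set cspan :: "'a set \<Rightarrow> 'a set" for B where
  cspan_ideal: "a \<in> I \<Longrightarrow> a \<in> cspan B"
| cspan_base: "b \<in> B \<Longrightarrow> b \<in> cspan B"
| cspan_add: "a \<in> cspan B \<Longrightarrow> b \<in> cspan B \<Longrightarrow> a + b \<in> cspan B"
| cspan_scale: "central c \<Longrightarrow> a \<in> cspan B \<Longrightarrow> c * a \<in> cspan B"

lemma cspan_eqv: "a \<approx> b \<Longrightarrow> b \<in> cspan B \<Longrightarrow> a \<in> cspan B"
  using cspan_add[OF cspan_ideal, of "a - b" b B] by simp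

text \<open>Left multiplication by \<open>g\<close> is linear over the centre, so it is enough to
  test it on \<open>B\<close>.\<close>

lemma cspan_mult_left:
  assumes "\<And>b. b \<in> B \<Longrightarrow> g * b \<in> cspan B" "a \<in> cspan B"
  shows "g * a \<in> cspan B"
  using assms(2)
proof induction
  case (cspan_scale c a)
  have "g * (c * a) \<approx> c * (g * a)"
    using eqv_mult_right[OF eqv_sym[OF centralD[OF cspan_scale(1)]], of g a]
    by (simp add: mult.assoc)
  then show ?case
    using cspan_eqv cspan.cspan_scale cspan_scale by blast
qed (auto simp: distrib_left assms(1) intro: cspan.intros mult_mem)

text \<open>Multilinear expansion reduces to arguments from \<open>B\<close>; two of these coincide
  by the pigeonhole principle, and the alternating property applies.\<close>

lemma std_eval_cspan:
  assumes B: "finite B" "card B < m" and r: "\<And>i. i < m \<Longrightarrow> r i \<in> cspan B"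
  shows "std_eval m r \<in> I"
proof -
  \<comment> \<open>Induction on the number \<open>k\<close> of arguments still to be expanded:
    those below \<open>k\<close> lie in the span, the others already in \<open>B\<close>.\<close>
  have "std_eval m r \<in> I"
    if "k \<le> m" "\<And>i. i < k \<Longrightarrow> r i \<in> cspan B" "\<And>i. k \<le> i \<Longrightarrow> i < m \<Longrightarrow> r i \<in> B" for k r
    using that
  proof (induction k arbitrary: r)
    case 0
    then have "r ` {..<m} \<subseteq> B" by auto
    then have "card (r ` {..<m}) < card {..<m}"
      using B card_mono[of B "r ` {..<m}"] by simp
    then have "\<not> inj_on r {..<m}" by (rule pigeonhole)
    then obtain i j where "i < m" "j < m" "i \<noteq> j" "r i = r j"
      by (auto simp: inj_on_def)
    then show ?case by (simp add: std_eval_repeated zero_mem)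
  next
    case (Suc k)
    then have k: "k < m" by simp
    from std_eval_slot[OF k] obtain L R where
      slot: "\<And>a. std_eval m (r(k := a)) = (\<Sum>\<sigma> | \<sigma> permutes {..<m}. L \<sigma> * a * R \<sigma>)"
      by metis
    have "std_eval m (r(k := a)) \<in> I" if "a \<in> cspan B" for a
      using that
    proof induction
      case (cspan_ideal a)
      then show ?case unfolding slot by (intro sum_mem mult_mem)
    next
      case (cspan_base b)
      show ?case
        using Suc.prems cspan_base by (intro Suc.IH) (auto intro: cspan.intros)
    next
      case (cspan_add a b)
      then show ?case unfolding slot
        by (simp add: algebra_simps sum.distrib add_mem)
    next
      case (cspan_scale c a)
      have "L \<sigma> * (c * a) * R \<sigma> - c * (L \<sigma> * a * R \<sigma>) \<in> I" for \<sigma>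
        using eqv_mult_right[OF eqv_sym[OF centralD[OF cspan_scale(1)]], of "L \<sigma>" "a * R \<sigma>"]
        by (simp add: mult.assoc)
      then have "std_eval m (r(k := c * a)) \<approx> c * std_eval m (r(k := a))"
        unfolding slot by (simp add: sum_distrib_left sum_mem flip: sum_subtractf)
      then show ?case
        using cspan_scale by (blast intro: eqv_mem mult_mem)
    qed
    from this[of "r k"] show ?case using Suc.prems by simp
  qed
  from this[of m r] show ?thesis using r by simp
qed

end

section \<open>Powers of the generators at a root of unity\<close>

context two_sided_ideal
begin

text \<open>Each passage of a factor \<open>u\<close> past \<open>v\<close> contributes one more
  power of \<open>s\<close>, so the constants add up to a Gaussian integer. For \<open>k = 0\<close>
  the truncated exponent \<open>k - 1\<close> meets an empty sum.\<close>

lemma q_commute_power_left: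
  assumes s: "\<And>a. s * a = a * s" and c: "\<And>a. c * a = a * c"
    and uv: "u * v \<approx> s * v * u + c"
  shows "u ^ k * v \<approx> s ^ k * v * u ^ k + (\<Sum>i<k. s ^ i) * c * u ^ (k - 1)"
proof (induction k)
  case 0
  show ?case by (simp add: zero_mem)
next
  case (Suc k)
  have sk: "s ^ k * a = a * s ^ k" for a
    by (metis power_commuting_commutes s)
  have S: "(\<Sum>i<k. s ^ i) * a = a * (\<Sum>i<k. s ^ i)" for a
    by (simp add: sum_distrib_left sum_distrib_right power_commuting_commutes s)
  have "u ^ Suc k * v = u * (u ^ k * v)" by (simp add: mult.assoc)
  also have "\<dots> \<approx> u * (s ^ k * v * u ^ k + (\<Sum>i<k. s ^ i) * c * u ^ (k - 1))"
    using Suc.IH by (rule eqv_mult_left)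
  also have "u * (s ^ k * v * u ^ k + (\<Sum>i<k. s ^ i) * c * u ^ (k - 1)) =
      s ^ k * (u * v) * u ^ k + (\<Sum>i<k. s ^ i) * c * u ^ k"
  proof -
    have "u * ((\<Sum>i<k. s ^ i) * c * u ^ (k - 1)) = u * (\<Sum>i<k. s ^ i) * c * u ^ (k - 1)"
      by (simp only: mult.assoc)
    also have "\<dots> = (\<Sum>i<k. s ^ i) * (u * c) * u ^ (k - 1)"
      by (simp only: S[of u, symmetric] mult.assoc)
    also have "\<dots> = (\<Sum>i<k. s ^ i) * c * (u * u ^ (k - 1))"
      by (simp only: c[of u, symmetric] mult.assoc)
    also have "\<dots> = (\<Sum>i<k. s ^ i) * c * u ^ k"
      by (cases k) simp_all
    moreover have "u * (s ^ k * v * u ^ k) = s ^ k * (u * v) * u ^ k"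
      using sk[of u] by (simp flip: mult.assoc)
    ultimately show ?thesis by (simp only: distrib_left)
  qed
  also have "\<dots> \<approx> s ^ k * (s * v * u + c) * u ^ k + (\<Sum>i<k. s ^ i) * c * u ^ k"
    using uv by (intro eqv_add eqv_refl eqv_mult_right eqv_mult_left)
  also have "s ^ k * (s * v * u + c) * u ^ k + (\<Sum>i<k. s ^ i) * c * u ^ k =
      s ^ Suc k * v * u ^ Suc k + (\<Sum>i<Suc k. s ^ i) * c * u ^ (Suc k - 1)"
    using sk[of s] by (simp add: distrib_left distrib_right add.assoc flip: mult.assoc)
  finally show ?case .
qed

lemma q_commute_power_right:
  assumes s: "\<And>a. s * a = a * s" and c: "\<And>a. c * a = a * c"
    and uv: "u * v \<approx> s * v * u + c"
  shows "u * v ^ k \<approx> s ^ k * v ^ k * u + (\<Sum>i<k. s ^ i) * c * v ^ (k - 1)"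
proof (induction k)
  case 0
  show ?case by (simp add: zero_mem)
next
  case (Suc k)
  have sk: "s ^ k * a = a * s ^ k" for a
    by (metis power_commuting_commutes s)
  have "u * v ^ Suc k = u * v ^ k * v" by (simp add: mult.assoc power_commutes)
  also have "\<dots> \<approx> (s ^ k * v ^ k * u + (\<Sum>i<k. s ^ i) * c * v ^ (k - 1)) * v"
    using Suc.IH by (rule eqv_mult_right)
  also have "(s ^ k * v ^ k * u + (\<Sum>i<k. s ^ i) * c * v ^ (k - 1)) * v =
      s ^ k * v ^ k * (u * v) + (\<Sum>i<k. s ^ i) * c * v ^ k"
  proof -
    have "(\<Sum>i<k. s ^ i) * c * (v ^ (k - 1) * v) = (\<Sum>i<k. s ^ i) * c * v ^ k"
      by (cases k) (simp_all add: power_commutes)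
    then show ?thesis by (simp add: algebra_simps)
  qed
  also have "\<dots> \<approx> s ^ k * v ^ k * (s * v * u + c) + (\<Sum>i<k. s ^ i) * c * v ^ k"
    using uv by (intro eqv_add eqv_refl eqv_mult_left)
  also have "s ^ k * v ^ k * (s * v * u + c) + (\<Sum>i<k. s ^ i) * c * v ^ k =
      s ^ Suc k * v ^ Suc k * u + (\<Sum>i<Suc k. s ^ i) * c * v ^ (Suc k - 1)"
  proof -
    have "s ^ k * v ^ k * (s * v * u) = s ^ Suc k * v ^ Suc k * u"
    proof -
      have "s ^ k * v ^ k * (s * v * u) = s ^ k * (v ^ k * s) * (v * u)"
        by (simp only: mult.assoc)
      also have "\<dots> = (s ^ k * s) * (v ^ k * v) * u"
        by (simp only: s[of "v ^ k", symmetric] mult.assoc)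
      finally show ?thesis by (simp only: power_Suc2)
    qed
    moreover have "s ^ k * v ^ k * c = s ^ k * c * v ^ k"
      by (simp only: c[of "v ^ k", symmetric] mult.assoc)
    ultimately show ?thesis by (simp add: distrib_left distrib_right add.assoc)
  qed
  finally show ?case .
qed

text \<open>\<open>s ^ n = 1\<close> removes the twist, and the vanishing Gaussian integer removes
  the constant term.\<close>

lemma q_commute_root_of_unity:
  assumes s: "\<And>a. s * a = a * s" and c: "\<And>a. c * a = a * c"
    and uv: "u * v \<approx> s * v * u + c"
    and root: "s ^ n = 1" "(\<Sum>i<n. s ^ i) = 0"
  shows "u ^ n * v \<approx> v * u ^ n" "u * v ^ n \<approx> v ^ n * u"
  using q_commute_power_left[OF s c uv, of n] q_commute_power_right[OF s c uv, of n]
  by (simp_all add: root)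

text \<open>Division with remainder splits off a power of the central \<open>u ^ n\<close>. The
  factors \<open>w\<close> and \<open>v\<close> allow the reduction at any place inside a
  monomial.\<close>

lemma central_power_reduce:
  assumes "central (u ^ n)" "\<And>k. k < n \<Longrightarrow> w * (u ^ k * v) \<in> cspan B" "n > 0"
  shows "w * (u ^ k * v) \<in> cspan B"
proof -
  have "w * (u ^ k * v) = w * (u ^ n) ^ (k div n) * (u ^ (k mod n) * v)"
    by (simp add: mult.assoc flip: power_mult power_add)
       (simp flip: mult.assoc power_add)
  also have "\<dots> \<approx> (u ^ n) ^ (k div n) * (w * (u ^ (k mod n) * v))"
    using eqv_mult_right[OF eqv_sym[OF centralD[OF central_power[OF assms(1)]]],
        of w "k div n" "u ^ (k mod n) * v"]
    by (simp add: mult.assoc)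
  finally show ?thesis
    using assms by (blast intro: cspan_eqv cspan_scale central_power mod_less_divisor)
qed

text \<open>A generator multiplied onto an ordered monomial is moved into place by the q-commutation
  rules, which leaves ordered monomials with central coefficients. Together the four claims will
  show that the span is the whole algebra.\<close>

lemma cspan_monomials:
  assumes p: "\<And>a. p * a = a * p" "\<And>a. p' * a = a * p'"
    and c: "\<And>a. \<alpha> * a = a * \<alpha>" "\<And>a. \<beta> * a = a * \<beta>" "\<And>a. \<gamma> * a = a * \<gamma>"
    and xy: "x * y \<approx> p * y * x + \<alpha>" and xz: "x * z \<approx> p' * z * x + \<beta>" and yz: "y * z \<approx> p * z * y + \<gamma>"
    and cen: "central (x ^ n)" "central (y ^ n)" "central (z ^ n)" and "n > 0"
  defines "B \<equiv> (\<lambda>(i, j, k). z ^ i * (y ^ j * x ^ k)) ` ({..<n} \<times> {..<n} \<times> {..<n})"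
  shows "1 \<in> cspan B"
    and "m \<in> cspan B \<Longrightarrow> x * m \<in> cspan B"
    and "m \<in> cspan B \<Longrightarrow> y * m \<in> cspan B"
    and "m \<in> cspan B \<Longrightarrow> z * m \<in> cspan B"
proof -
  have central: "central a" if "\<And>b. a * b = b * a" for a
    using that by (simp add: central_def zero_mem)
  have pow: "s ^ k * a = a * s ^ k" if "\<And>a. s * a = a * s" for s a :: 'a and k
    by (metis power_commuting_commutes that)
  have coeff: "central ((\<Sum>i<k. s ^ i) * b)" if "\<And>a. s * a = a * s" "\<And>a. b * a = a * b" for s b k
  proof (rule central)
    fix a
    have "(\<Sum>i<k. s ^ i) * a = a * (\<Sum>i<k. s ^ i)"
      by (simp add: sum_distrib_left sum_distrib_right pow that)
    then show "(\<Sum>i<k. s ^ i) * b * a = a * ((\<Sum>i<k. s ^ i) * b)"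
      by (metis mult.assoc that(2))
  qed
  \<comment> \<open>Exponents are brought below \<open>n\<close> one at a time, first that of
    \<open>x\<close>, then that of \<open>y\<close>, then that of \<open>z\<close>.\<close>
  have mon: "z ^ i * (y ^ j * x ^ k) \<in> cspan B" for i j k
  proof -
    have 1: "z ^ i * (y ^ j * x ^ k) \<in> cspan B" if "i < n" "j < n" "k < n" for i j k
      using that unfolding B_def by (intro cspan_base) force
    have 2: "(z ^ i * y ^ j) * (x ^ k * 1) \<in> cspan B" if "i < n" "j < n" for i j k
      by (rule central_power_reduce[OF cen(1) _ \<open>n > 0\<close>]) (simp add: mult.assoc 1 that)
    have 3: "z ^ i * (y ^ j * x ^ k) \<in> cspan B" if "i < n" for i j k
      by (rule central_power_reduce[OF cen(2) _ \<open>n > 0\<close>]) (use 2 that in \<open>simp add: mult.assoc\<close>)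
    have "1 * (z ^ i * (y ^ j * x ^ k)) \<in> cspan B"
      by (rule central_power_reduce[OF cen(3) _ \<open>n > 0\<close>]) (simp add: 3)
    then show ?thesis by simp
  qed
  from mon[of 0 0 0] show "1 \<in> cspan B" by simp
  have zB: "z * b \<in> cspan B" if "b \<in> B" for b
    using that mon[of "Suc _"] by (auto simp: B_def mult.assoc)
  then show "m \<in> cspan B \<Longrightarrow> z * m \<in> cspan B"
    by (rule cspan_mult_left)
  have yB: "y * b \<in> cspan B" if "b \<in> B" for b
  proof -
    from that obtain i j k where b: "b = z ^ i * (y ^ j * x ^ k)"
      by (auto simp: B_def)
    have "y * b = y * z ^ i * (y ^ j * x ^ k)" by (simp add: b mult.assoc)
    also have "\<dots> \<approx> (p ^ i * z ^ i * y + (\<Sum>i<i. p ^ i) * \<gamma> * z ^ (i - 1)) * (y ^ j * x ^ k)"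
      by (intro eqv_mult_right q_commute_power_right p c yz)
    also have "(p ^ i * z ^ i * y + (\<Sum>i<i. p ^ i) * \<gamma> * z ^ (i - 1)) * (y ^ j * x ^ k) =
        p ^ i * (z ^ i * (y ^ Suc j * x ^ k)) + (\<Sum>i<i. p ^ i) * \<gamma> * (z ^ (i - 1) * (y ^ j * x ^ k))"
      by (simp add: distrib_right mult.assoc)
    finally show ?thesis
      by (rule cspan_eqv)
         (intro cspan_add cspan_scale mon coeff p c central_power central)
  qed
  then show "m \<in> cspan B \<Longrightarrow> y * m \<in> cspan B"
    by (rule cspan_mult_left)
  have xB: "x * b \<in> cspan B" if "b \<in> B" for b
  proof -
    from that obtain i j k where b: "b = z ^ i * (y ^ j * x ^ k)"
      by (auto simp: B_def)
    have "x * b = x * z ^ i * (y ^ j * x ^ k)" by (simp add: b mult.assoc)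
    also have "\<dots> \<approx> (p' ^ i * z ^ i * x + (\<Sum>i<i. p' ^ i) * \<beta> * z ^ (i - 1)) * (y ^ j * x ^ k)"
      by (intro eqv_mult_right q_commute_power_right p c xz)
    also have "(p' ^ i * z ^ i * x + (\<Sum>i<i. p' ^ i) * \<beta> * z ^ (i - 1)) * (y ^ j * x ^ k) =
        p' ^ i * (z ^ i * (x * y ^ j * x ^ k)) + (\<Sum>i<i. p' ^ i) * \<beta> * (z ^ (i - 1) * (y ^ j * x ^ k))"
      by (simp add: distrib_right mult.assoc)
    finally have *: "x * b \<approx> \<dots>" .
    \<comment> \<open>\<open>x\<close> still has to pass \<open>y ^ j\<close>; the coefficients
      created on the way stand to the right of \<open>z ^ i\<close> and are then moved to its
      left.\<close>
    have "z ^ i * (x * y ^ j * x ^ k) \<approx>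
        z ^ i * ((p ^ j * y ^ j * x + (\<Sum>i<j. p ^ i) * \<alpha> * y ^ (j - 1)) * x ^ k)"
      by (intro eqv_mult_left eqv_mult_right q_commute_power_right p c xy)
    also have "z ^ i * ((p ^ j * y ^ j * x + (\<Sum>i<j. p ^ i) * \<alpha> * y ^ (j - 1)) * x ^ k) =
        (z ^ i * p ^ j) * (y ^ j * x ^ Suc k) + (z ^ i * ((\<Sum>i<j. p ^ i) * \<alpha>)) * (y ^ (j - 1) * x ^ k)"
      by (simp add: distrib_left distrib_right mult.assoc)
    also have "\<dots> \<approx>
        (p ^ j * z ^ i) * (y ^ j * x ^ Suc k) + (((\<Sum>i<j. p ^ i) * \<alpha>) * z ^ i) * (y ^ (j - 1) * x ^ k)"
      by (intro eqv_add eqv_mult_right) (intro eqv_sym[OF centralD] central_power central coeff p c)+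
    finally have "z ^ i * (x * y ^ j * x ^ k) \<in> cspan B"
      by (rule cspan_eqv)
         (simp only: mult.assoc[of _ "z ^ i"], intro cspan_add cspan_scale mon coeff p c central_power central)
    then have "p' ^ i * (z ^ i * (x * y ^ j * x ^ k)) \<in> cspan B"
      by (rule cspan_scale[OF central_power[OF central[OF p(2)]]])
    moreover have "(\<Sum>i<i. p' ^ i) * \<beta> * (z ^ (i - 1) * (y ^ j * x ^ k)) \<in> cspan B"
      by (intro cspan_scale coeff p c mon)
    ultimately show ?thesis
      by (intro cspan_eqv[OF *] cspan_add)
  qed
  then show "m \<in> cspan B \<Longrightarrow> x * m \<in> cspan B"
    by (rule cspan_mult_left)
qed

end

section \<open>The quantum Weyl algebra at a root of unity\<close>

lemma free_algebra_induct_single [case_names single add]: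
  fixes a :: "('x, 'k::ring_1) free_algebra"
  assumes single: "\<And>w c. P (Poly_Mapping.single w c)"
    and add: "\<And>a b. P a \<Longrightarrow> P b \<Longrightarrow> P (a + b)"
  shows "P a"
proof (induction a rule: Poly_Mapping.update_induct)
  case const
  show ?case using single[of 0 0] by simp
next
  case (update f w b)
  then have "P (f + Poly_Mapping.single w b)"
    using single add by blast
  also have "f + Poly_Mapping.single w b = Poly_Mapping.update w b f"
    using update
    by (intro poly_mapping_eqI)
       (auto simp: lookup_update lookup_add lookup_single when_def in_keys_iff)
  finally show ?case .
qed

text \<open>Words grow by prepending a letter, so closure under left multiplication by generators
  replaces a case for general products.\<close>

lemma free_algebra_induct [case_names scal add gen]:
  fixes a :: "('x, 'k::ring_1) free_algebra"
  assumes scal: "\<And>c. P (scal c)" and add: "\<And>a b. P a \<Longrightarrow> P b \<Longrightarrow> P (a + b)"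
    and gen: "\<And>g a. P a \<Longrightarrow> P (gen g * a)"
  shows "P a"
proof (induction a rule: free_algebra_induct_single)
  case (single w c)
  have "P (Poly_Mapping.single (Word xs) c)" for xs
  proof (induction xs)
    case Nil
    show ?case using scal[of c] by (simp add: scal_def zero_free_mon_def)
  next
    case (Cons g xs)
    then show ?case using gen[OF Cons, of g] by (simp add: gen_def mult_single plus_free_mon_def)
  qed
  from this[of "letters w"] show ?case by simp
qed (rule add)

lemma scal_add: "scal (a + b) = scal a + scal b"
  by (simp add: scal_def single_add)

lemma scal_diff: "scal (a - b) = scal a - scal b"
  by (simp add: scal_def single_diff)

lemma scal_mult: "scal (a * b) = scal a * scal b"
  by (simp add: scal_def mult_single)

lemma scal_0: "scal 0 = 0"
  by (simp add: scal_def)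

lemma scal_1: "scal 1 = 1"
  by (simp add: scal_def)

lemma scal_power: "scal (a ^ k) = scal a ^ k"
  by (induction k) (simp_all add: scal_1 scal_mult)

lemma scal_sum: "scal (sum f S) = (\<Sum>i\<in>S. scal (f i))"
  by (induction S rule: infinite_finite_induct) (simp_all add: scal_0 scal_add)

lemma sum_powers_root_of_unity:
  fixes p :: "'k::field"
  assumes "p ^ n = 1" "p \<noteq> 1"
  shows "(\<Sum>i<n. p ^ i) = 0"
  using assms by (simp add: sum_gp_strict)

lemma two_sided_ideal_cyclic_weyl: "two_sided_ideal (cyclic_weyl_ideal q \<alpha> \<beta> \<gamma>)"
  using ideal_cyclic_weyl_ideal by (simp flip: ideal_type_algebra_iff)

lemma cyclic_weyl_rels_subset: "cyclic_weyl_rels q \<alpha> \<beta> \<gamma> \<subseteq> cyclic_weyl_ideal q \<alpha> \<beta> \<gamma>"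
  unfolding cyclic_weyl_ideal_def
  by (rule ring.genideal_self[OF ring_of_type_algebra_ring]) (simp add: ring_of_type_algebra_simps)

lemma PI_ring_cyclic_weyl_if_root_of_unity:
  fixes q \<alpha> \<beta> \<gamma> :: "'k::field"
  assumes "q \<noteq> 0" "q\<^sup>2 \<noteq> 1" "n \<ge> 1" and root: "(q\<^sup>2) ^ n = 1"
  shows "PI_ring (cyclic_weyl q \<alpha> \<beta> \<gamma>)"
proof -
  have "n > 0" using \<open>n \<ge> 1\<close> by simp
  define I where "I = cyclic_weyl_ideal q \<alpha> \<beta> \<gamma>"
  interpret two_sided_ideal I
    unfolding I_def by (rule two_sided_ideal_cyclic_weyl)
  let ?x = "gen Gx :: (xyz, 'k) free_algebra" and ?y = "gen Gy :: (xyz, 'k) free_algebra"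
    and ?z = "gen Gz :: (xyz, 'k) free_algebra"
  let ?p = "scal (q\<^sup>2) :: (xyz, 'k) free_algebra"
  let ?pinv = "scal (inverse (q\<^sup>2)) :: (xyz, 'k) free_algebra"
  have rel: "?x * ?y - (?p * ?y * ?x + scal \<alpha>) \<in> I" "?x * ?z - (?pinv * ?z * ?x + scal \<beta>) \<in> I"
    "?y * ?z - (?p * ?z * ?y + scal \<gamma>) \<in> I"
    using cyclic_weyl_rels_subset[of q \<alpha> \<beta> \<gamma>] unfolding I_def cyclic_weyl_rels_def by auto
  have root': "inverse (q\<^sup>2) ^ n = 1"
    using root by (simp add: power_inverse)
  have p: "?p ^ n = 1" "?pinv ^ n = 1"
    by (metis root scal_1 scal_power) (metis root' scal_1 scal_power)
  have sum_p: "(\<Sum>i<n. ?p ^ i) = 0" "(\<Sum>i<n. ?pinv ^ i) = 0"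
    using sum_powers_root_of_unity[OF root] sum_powers_root_of_unity[OF root'] assms
    by (simp_all add: inverse_eq_1_iff flip: scal_power scal_sum scal_0)
  note xy = q_commute_root_of_unity[OF scal_central scal_central rel(1) p(1) sum_p(1)]
  note xz = q_commute_root_of_unity[OF scal_central scal_central rel(2) p(2) sum_p(2)]
  note yz = q_commute_root_of_unity[OF scal_central scal_central rel(3) p(1) sum_p(1)]
  \<comment> \<open>Commuting with the generators suffices, by induction on the other
    factor.\<close>
  have central: "central c" if "\<And>g. c * gen g - gen g * c \<in> I" for c
    unfolding central_def
  proof
    fix a
    show "c * a - a * c \<in> I"
    proof (induction a rule: free_algebra_induct)
      case (scal d)
      show ?case by (simp add: scal_central[of d c] zero_mem)
    next
      case (add a b)
      then show ?case using eqv_add by (simp add: distrib_left distrib_right)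
    next
      case (gen g a)
      have "c * (gen g * a) - gen g * c * a \<in> I"
        using eqv_mult_right[OF that, of g a] by (simp add: mult.assoc)
      moreover have "gen g * c * a - gen g * a * c \<in> I"
        using eqv_mult_left[OF gen, of "gen g"] by (simp add: mult.assoc)
      ultimately show ?case by (rule eqv_trans)
    qed
  qed
  have "central (?x ^ n)" "central (?y ^ n)" "central (?z ^ n)"
    by (rule central; case_tac g;
        simp add: xy xz yz eqv_sym[OF xy(2)] eqv_sym[OF xz(2)] eqv_sym[OF yz(2)]
          power_commutes zero_mem)+
  note mon = cspan_monomials[OF scal_central scal_central scal_central scal_central scal_central
      rel this \<open>n > 0\<close>]
  define B where "B = (\<lambda>(i, j, k). ?z ^ i * (?y ^ j * ?x ^ k)) ` ({..<n} \<times> {..<n} \<times> {..<n})"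
  note mon = mon[folded B_def]
  have span: "a \<in> cspan B" for a
  proof (induction a rule: free_algebra_induct)
    case (scal c)
    have "scal c * 1 \<in> cspan B"
      using mon(1) by (intro cspan_scale) (auto simp: central_def scal_central zero_mem)
    then show ?case by simp
  next
    case (gen g a)
    then show ?case by (cases g) (simp_all add: mon)
  qed (rule cspan_add)
  have "finite B" by (simp add: B_def)
  \<comment> \<open>One variable more than there are spanning monomials.\<close>
  then have "word_eval r (std_poly (Suc (card B))) \<in> I" for r
    unfolding word_eval_std_poly using span by (intro std_eval_cspan) auto
  then show ?thesis
    unfolding cyclic_weyl_def PI_ring_quotient_iff[OF two_sided_ideal_cyclic_weyl]
    using nc_monic_std_poly std_poly_letters unfolding I_def by blast
qed

section \<open>Modules over a free algebra\<close>

text \<open>Extends \<open>T\<close> from the generators to the free algebra; with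
  \<open>foldr\<close> the leftmost letter acts last, as in a left module.\<close>

definition act :: "('x \<Rightarrow> ('i \<Rightarrow> 'k) \<Rightarrow> 'i \<Rightarrow> 'k) \<Rightarrow> ('x, 'k::field) free_algebra \<Rightarrow> ('i \<Rightarrow> 'k) \<Rightarrow> 'i \<Rightarrow> 'k"
  where "act T a g i = (\<Sum>w\<in>Poly_Mapping.keys a. Poly_Mapping.lookup a w * foldr T (letters w) g i)"

lemma act_superset:
  assumes "finite S" "Poly_Mapping.keys a \<subseteq> S"
  shows "act T a g i = (\<Sum>w\<in>S. Poly_Mapping.lookup a w * foldr T (letters w) g i)"
  unfolding act_def using assms by (intro sum.mono_neutral_left) (auto simp: in_keys_iff)

lemma act_add: "act T (a + b) g i = act T a g i + act T b g i"
proof -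
  let ?S = "Poly_Mapping.keys a \<union> Poly_Mapping.keys b"
  have "act T c g i = (\<Sum>w\<in>?S. Poly_Mapping.lookup c w * foldr T (letters w) g i)"
    if "Poly_Mapping.keys c \<subseteq> ?S" for c
    using that by (intro act_superset) auto
  from this[of "a + b"] this[of a] this[of b] show ?thesis
    using Poly_Mapping.keys_add[of a b] by (simp add: lookup_add distrib_right sum.distrib)
qed

lemma act_zero: "act T 0 g i = 0"
  by (simp add: act_def)

lemma act_sum: "act T (sum a S) g i = (\<Sum>s\<in>S. act T (a s) g i)"
  by (induction S rule: infinite_finite_induct) (simp_all add: act_zero act_add)

lemma act_single: "act T (Poly_Mapping.single w c) g i = c * foldr T (letters w) g i"
  by (simp add: act_def)

lemma act_scal: "act T (scal c) g i = c * g i"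
  by (simp add: scal_def act_single zero_free_mon_def)

lemma act_gen: "act T (gen x) g i = T x g i"
  by (simp add: gen_def act_single)

lemma act_uminus: "act T (- a) g i = - act T a g i"
  using act_add[of T a "- a" g i] by (simp add: act_zero add_eq_0_iff)

lemma act_diff: "act T (a - b) g i = act T a g i - act T b g i"
  using act_add[of T a "- b" g i] by (simp add: act_uminus)

locale linear_operators =
  fixes T :: "'x \<Rightarrow> ('i \<Rightarrow> 'k::field) \<Rightarrow> 'i \<Rightarrow> 'k"
  assumes linear: "T x (\<lambda>i. c * g i + h i) = (\<lambda>i. c * T x g i + T x h i)"
begin

lemma op_zero: "T x (\<lambda>i. 0) = (\<lambda>i. 0)"
  using linear[of x "- 1" "\<lambda>i. 0" "\<lambda>i. 0"] by simp

lemma op_scale: "T x (\<lambda>i. c * g i) = (\<lambda>i. c * T x g i)"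
  using linear[of x c g "\<lambda>i. 0"] by (simp add: op_zero)

lemma op_add: "T x (\<lambda>i. g i + h i) = (\<lambda>i. T x g i + T x h i)"
  using linear[of x 1 g h] by simp

lemma act_gen_mult: "act T (gen x * a) g = T x (act T a g)"
proof (induction a rule: free_algebra_induct_single)
  case (single w c)
  have "gen x * Poly_Mapping.single w c = Poly_Mapping.single (Word (x # letters w)) c"
    by (simp add: gen_def mult_single plus_free_mon_def)
  then show ?case
    using op_scale[of x c "foldr T (letters w) g"] by (simp add: act_single[abs_def])
next
  case (add a b)
  then show ?case
    using op_add[of x "act T a g" "act T b g"] by (simp add: act_add[abs_def] distrib_left)
qed

lemma act_scal_mult: "act T (scal c * a) g i = c * act T a g i"
proof (induction a arbitrary: i rule: free_algebra_induct)
  case (scal d)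
  have "scal c * (scal d :: ('x, 'k) free_algebra) = scal (c * d)"
    by (simp add: scal_mult)
  then show ?case by (simp add: act_scal)
next
  case (add a b)
  then show ?case by (simp add: distrib_left act_add)
next
  case (gen x a)
  have "scal c * (gen x * a) = gen x * (scal c * a)"
    by (metis mult.assoc scal_central)
  moreover have "act T (scal c * a) g = (\<lambda>i. c * act T a g i)"
    using gen by blast
  ultimately show ?case by (simp add: act_gen_mult op_scale)
qed

text \<open>The universal property of the free algebra: linear operators assigned to the generators
  extend to a representation.\<close>

lemma act_mult: "act T (a * b) g = act T a (act T b g)"
proof (induction a rule: free_algebra_induct)
  case (scal c)
  show ?case by (rule ext) (simp add: act_scal_mult act_scal)
next
  case (add a b)
  then show ?case by (intro ext) (simp add: distrib_right act_add)
next
  case (gen x a)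
  then show ?case by (simp add: act_gen_mult mult.assoc)
qed

lemma act_zero_right: "act T a (\<lambda>i. 0) = (\<lambda>i. 0)"
  by (induction a rule: free_algebra_induct)
     (auto simp: act_scal act_add act_gen_mult op_zero)

text \<open>Reduces the vanishing of a whole ideal on the module to a check of its generating
  relations.\<close>

lemma annihilator_ideal: "two_sided_ideal {a. \<forall>g. act T a g = (\<lambda>i. 0)}"
  by unfold_locales (auto simp: act_zero act_add act_mult act_zero_right)

end

section \<open>The quantum Weyl algebra away from roots of unity\<close>

text \<open>The Gaussian integer \<open>1 + p + ... + p ^ (n - 1)\<close> in Horner form.\<close>

primrec q_num :: "'k::field \<Rightarrow> nat \<Rightarrow> 'k" where
  "q_num p 0 = 0"
| "q_num p (Suc n) = p * q_num p n + 1"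

text \<open>Gaussian integers at \<open>p\<close> and at its inverse differ only by a power of
  \<open>p\<close>. The identity balances the mixed \<alpha> \<beta> terms in
  \<open>weyl_op_yz\<close>.\<close>

lemma q_num_inverse:
  assumes "p * p' = 1"
  shows "q_num p (Suc n) * q_num p' n = p * q_num p' (Suc n) * q_num p n"
proof (induction n)
  case (Suc n)
  have "(p * (p * A + 1) + 1) * (p' * B + 1) = p * (p' * (p' * B + 1) + 1) * (p * A + 1)"
    if "(p * A + 1) * B = p * (p' * B + 1) * A" for A B
    using assms that by Groebner_Basis.algebra
  from this[of "q_num p n" "q_num p' n"] Suc show ?case by simp
qed simp

text \<open>
  The module generated by \<open>v\<close> subject to \<open>x v = v\<close> has the basis \<open>z\<^sup>a y\<^sup>b v\<close>.  Its linear dual is a right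
  module; reading it as a left module over the opposite algebra interchanges \<open>x\<close> with \<open>z\<close> and
  \<open>\<alpha>\<close> with \<open>\<gamma>\<close>, which gives the formulas below.  The truncated subtractions are harmless: whenever they
  truncate, the factor \<open>q_num _ 0 = 0\<close> is present.
\<close>

fun weyl_op :: "'k::field \<Rightarrow> 'k \<Rightarrow> 'k \<Rightarrow> 'k \<Rightarrow> xyz \<Rightarrow> (nat \<times> nat \<Rightarrow> 'k) \<Rightarrow> nat \<times> nat \<Rightarrow> 'k" where
  "weyl_op p \<alpha> \<beta> \<gamma> Gx g (a, b) = g (Suc a, b)"
| "weyl_op p \<alpha> \<beta> \<gamma> Gy g (a, b) = p ^ a * g (a, Suc b) + q_num p a * \<alpha> * g (a - 1, b)"
| "weyl_op p \<alpha> \<beta> \<gamma> Gz g (a, b) =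
    inverse p ^ a * (p ^ b * g (a, b) + q_num p b * \<gamma> * g (a, b - 1))
      + q_num (inverse p) a * \<beta> * g (a - 1, b)"

lemma linear_operators_weyl_op: "linear_operators (weyl_op p \<alpha> \<beta> \<gamma>)"
proof (unfold_locales, rule ext)
  fix x c and g h :: "nat \<times> nat \<Rightarrow> 'a" and i
  show "weyl_op p \<alpha> \<beta> \<gamma> x (\<lambda>i. c * g i + h i) i = c * weyl_op p \<alpha> \<beta> \<gamma> x g i + weyl_op p \<alpha> \<beta> \<gamma> x h i"
    by (cases i; cases x) (simp_all add: algebra_simps)
qed

lemma weyl_op_xy:
  "weyl_op p \<alpha> \<beta> \<gamma> Gx (weyl_op p \<alpha> \<beta> \<gamma> Gy g) i =
    p * weyl_op p \<alpha> \<beta> \<gamma> Gy (weyl_op p \<alpha> \<beta> \<gamma> Gx g) i + \<alpha> * g i"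
proof (cases i)
  case (Pair a b)
  then show ?thesis by (cases a) (simp_all add: algebra_simps)
qed

lemma weyl_op_xz:
  "weyl_op p \<alpha> \<beta> \<gamma> Gx (weyl_op p \<alpha> \<beta> \<gamma> Gz g) i =
    inverse p * weyl_op p \<alpha> \<beta> \<gamma> Gz (weyl_op p \<alpha> \<beta> \<gamma> Gx g) i + \<beta> * g i"
proof (cases i)
  case (Pair a b)
  then show ?thesis by (cases a) (simp_all add: algebra_simps)
qed

text \<open>\<open>u\<close> and \<open>v\<close> stand for \<open>p ^ n\<close> and its inverse,
  \<open>A\<close> and \<open>B\<close> for \<open>q_num p n\<close> and \<open>q_num p' n\<close>,
  \<open>P\<close> and \<open>N\<close> for \<open>p ^ b\<close> and \<open>q_num p b\<close>, and
  each \<open>G\<close> for a value of \<open>g\<close>. What remains is a polynomial identity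
  modulo the hypotheses.\<close>

lemma weyl_op_yz_aux:
  fixes p :: "'k::field"
  assumes "p * p' = 1" "u * v = 1" "(p * A + 1) * B = p * (p' * B + 1) * A" "N * G2' = N * G2"
  shows "p * u * (p' * v * (p * P * G1 + (p * N + 1) * \<gamma> * G2) + (p' * B + 1) * \<beta> * G3) +
      (p * A + 1) * \<alpha> * (v * (P * G4 + N * \<gamma> * G6) + B * \<beta> * G5) =
    p * (p' * v * (P * (p * u * G1 + (p * A + 1) * \<alpha> * G4) +
        N * \<gamma> * (p * u * G2' + (p * A + 1) * \<alpha> * G6)) +
      (p' * B + 1) * \<beta> * (u * G3 + A * \<alpha> * G5)) + \<gamma> * G2"
  using assms by Groebner_Basis.algebra

lemma weyl_op_yz:
  assumes "p \<noteq> 0"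
  shows "weyl_op p \<alpha> \<beta> \<gamma> Gy (weyl_op p \<alpha> \<beta> \<gamma> Gz g) i =
    p * weyl_op p \<alpha> \<beta> \<gamma> Gz (weyl_op p \<alpha> \<beta> \<gamma> Gy g) i + \<gamma> * g i"
proof (cases i)
  case (Pair a b)
  \<comment> \<open>The two indices differ only for \<open>b = 0\<close>, where the Gaussian integer
    is zero.\<close>
  have b: "q_num p b * g (a, Suc (b - 1)) = q_num p b * g (a, b)"
    by (cases b) simp_all
  show ?thesis
  proof (cases a)
    case 0
    then show ?thesis
      by (cases b) (simp_all add: Pair algebra_simps)
  next
    case (Suc n)
    have inv: "p ^ n * inverse p ^ n = 1" "p * inverse p = 1"
      using assms by (simp_all flip: power_mult_distrib)
    show ?thesis
      unfolding Pair Suc weyl_op.simps q_num.simps diff_Suc_1 power_Suc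
      using inv q_num_inverse[OF inv(2), of n] b
      by (intro weyl_op_yz_aux) (simp_all add: Suc)
  qed
qed

text \<open>Only the row with first index 0 is inspected: there \<open>q_num _ 0 = 0\<close> removes
  the \<alpha> and \<beta> terms of the operators. The coefficient \<open>c\<close> may be
  zero.\<close>

definition leading :: "nat \<Rightarrow> 'k::field \<Rightarrow> (nat \<times> nat \<Rightarrow> 'k) \<Rightarrow> bool"
  where "leading n c g \<longleftrightarrow> (\<forall>b<n. g (0, b) = 0) \<and> g (0, n) = c"

text \<open>On the inspected row \<open>z\<close> is lower triangular with diagonal entries
  \<open>p ^ b\<close>.\<close>

lemma leading_z: "leading n c g \<Longrightarrow> leading n (p ^ n * c) (weyl_op p \<alpha> \<beta> \<gamma> Gz g)"
  by (cases n) (auto simp: leading_def)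

lemma leading_y: "leading (Suc n) c g \<Longrightarrow> leading n c (weyl_op p \<alpha> \<beta> \<gamma> Gy g)"
  by (auto simp: leading_def)

lemma power_eq_iff_not_root_of_unity:
  fixes p :: "'k::field"
  assumes "p \<noteq> 0" "\<And>n. n \<ge> 1 \<Longrightarrow> p ^ n \<noteq> 1"
  shows "p ^ j = p ^ k \<longleftrightarrow> j = k"
proof -
  have "j = k" if "p ^ j = p ^ k" "j \<le> k" for j k
  proof -
    have "p ^ k = p ^ j * p ^ (k - j)"
      by (metis le_add_diff_inverse power_add that(2))
    then have "p ^ (k - j) = 1"
      using that assms(1) by simp
    then show ?thesis using assms(2)[of "k - j"] that by fastforce
  qed
  from this[of j k] this[of k j] show ?thesis by (cases j k rule: linorder_cases) auto
qed

text \<open>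
  On leading coefficients \<open>z\<close> acts with the distinct eigenvalues \<open>p\<^sup>n\<close>, so Lagrange interpolation
  in \<open>z\<close> yields projections.
\<close>

definition interpolator :: "'k::field \<Rightarrow> nat \<Rightarrow> nat \<Rightarrow> (xyz, 'k) free_algebra"
  where "interpolator p d j =
    prod_list (map (\<lambda>k. scal (inverse (p ^ j - p ^ k)) * (gen Gz - scal (p ^ k)))
      (filter (\<lambda>k. k \<noteq> j) [0..<d]))"

text \<open>A polynomial in \<open>z\<close> multiplies the leading coefficient in position
  \<open>n\<close> by its value at \<open>p ^ n\<close>; here it is a product of linear
  factors.\<close>

lemma leading_act_prod_list:
  assumes "leading n c g"
  shows "leading n (c * (\<Prod>k\<leftarrow>ks. u k * (p ^ n - v k)))
    (act (weyl_op p \<alpha> \<beta> \<gamma>) (prod_list (map (\<lambda>k. scal (u k) * (gen Gz - scal (v k))) ks)) g)"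
proof -
  interpret linear_operators "weyl_op p \<alpha> \<beta> \<gamma>" by (rule linear_operators_weyl_op)
  show ?thesis
  proof (induction ks)
    case Nil
    then show ?case using assms act_scal[of "weyl_op p \<alpha> \<beta> \<gamma>" 1 g]
      by (simp add: leading_def scal_1)
  next
    case (Cons k ks)
    show ?case
      using Cons leading_z[OF Cons, of p \<alpha> \<beta> \<gamma>]
      by (auto simp: leading_def act_mult act_scal act_diff act_gen algebra_simps)
  qed
qed

lemma leading_interpolator:
  assumes p: "p \<noteq> 0" "\<And>n. n \<ge> 1 \<Longrightarrow> p ^ n \<noteq> 1" and "n < d" "leading n c g"
  shows "leading n (if n = j then c else 0) (act (weyl_op p \<alpha> \<beta> \<gamma>) (interpolator p d j) g)"
proof -
  have "(\<Prod>k\<leftarrow>filter (\<lambda>k. k \<noteq> j) [0..<d]. inverse (p ^ j - p ^ k) * (p ^ n - p ^ k)) =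
      (if n = j then 1 else 0)"
  proof (cases "n = j")
    case True
    have "(\<Prod>k\<leftarrow>filter (\<lambda>k. k \<noteq> j) [0..<d]. inverse (p ^ j - p ^ k) * (p ^ n - p ^ k)) =
        (\<Prod>k\<leftarrow>filter (\<lambda>k. k \<noteq> j) [0..<d]. 1)"
      using True
      by (intro arg_cong[of _ _ prod_list] map_cong refl)
         (auto simp: power_eq_iff_not_root_of_unity[OF p])
    also have "\<dots> = 1" by (induction d) auto
    finally show ?thesis using True by simp
  next
    case False
    \<comment> \<open>The factor for \<open>k = n\<close> is in the list and vanishes.\<close>
    then show ?thesis using \<open>n < d\<close>
      by (auto simp: prod_list_zero_iff intro!: image_eqI[of _ _ n])
  qed
  with leading_act_prod_list[OF assms(4), of "\<lambda>k. inverse (p ^ j - p ^ k)" p "\<lambda>k. p ^ k"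
      "filter (\<lambda>k. k \<noteq> j) [0..<d]" \<alpha> \<beta> \<gamma>]
  show ?thesis
    by (cases "n = j") (simp_all add: interpolator_def)
qed

text \<open>
  Substituting \<open>detector p w i\<close> for the \<open>i\<close>th variable, the only word of length at most
  \<open>length w\<close> that reads off the leading coefficient in position \<open>length w\<close> is \<open>w\<close> itself.
\<close>

definition detector :: "'k::field \<Rightarrow> nat list \<Rightarrow> nat \<Rightarrow> (xyz, 'k) free_algebra"
  where "detector p w i = (\<Sum>j | j < length w \<and> w ! j = i. interpolator p (length w) j) * gen Gy"

text \<open>\<open>y\<close> first lowers the position to \<open>n\<close>; there only the summand
  \<open>j = n\<close> survives, and it is present exactly when \<open>w ! n = i\<close>.\<close>

lemma leading_detector:
  assumes p: "p \<noteq> 0" "\<And>n. n \<ge> 1 \<Longrightarrow> p ^ n \<noteq> 1" and n: "n < length w" and "leading (Suc n) c g"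
  shows "leading n (if w ! n = i then c else 0) (act (weyl_op p \<alpha> \<beta> \<gamma>) (detector p w i) g)"
proof -
  let ?T = "weyl_op p \<alpha> \<beta> \<gamma>"
  interpret linear_operators ?T by (rule linear_operators_weyl_op)
  let ?g = "?T Gy g"
  let ?J = "{j. j < length w \<and> w ! j = i}"
  have g: "leading n c ?g" using assms(4) by (rule leading_y)
  have act: "act ?T (detector p w i) g t = (\<Sum>j\<in>?J. act ?T (interpolator p (length w) j) ?g t)" for t
    by (simp add: detector_def act_mult act_sum act_gen[abs_def])
  have lead: "leading n (if n = j then c else 0) (act ?T (interpolator p (length w) j) ?g)" for j
    by (rule leading_interpolator[OF p n g])
  have "(\<Sum>j\<in>?J. if n = j then c else 0) = (if w ! n = i then c else 0)"
    using n by (subst sum.delta') auto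
  then show ?thesis
    using lead unfolding leading_def act by simp
qed

text \<open>Each letter of \<open>v\<close>, read from the right, lowers the position by one and is
  compared with the letter of \<open>w\<close> at the new position.\<close>

lemma leading_detector_word:
  assumes p: "p \<noteq> 0" "\<And>n. n \<ge> 1 \<Longrightarrow> p ^ n \<noteq> 1"
    and "leading n c g" "length v \<le> n" "n \<le> length w"
  shows "leading (n - length v) (if v = take (length v) (drop (n - length v) w) then c else 0)
    (act (weyl_op p \<alpha> \<beta> \<gamma>) (prod_list (map (detector p w) v)) g)"
  using assms(4)
proof (induction v)
  case Nil
  then show ?case using assms(3) act_scal[of "weyl_op p \<alpha> \<beta> \<gamma>" 1 g]
    by (simp add: leading_def scal_1)
next
  case (Cons i v)
  interpret linear_operators "weyl_op p \<alpha> \<beta> \<gamma>" by (rule linear_operators_weyl_op)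
  define m where "m = n - length (i # v)"
  have m: "n - length v = Suc m" "m < length w"
    using Cons.prems assms(5) by (auto simp: m_def)
  have "take (Suc (length v)) (drop m w) = w ! m # take (length v) (drop (Suc m) w)"
    using m(2) by (simp flip: Cons_nth_drop_Suc)
  then have split: "i # v = take (length (i # v)) (drop m w) \<longleftrightarrow>
      w ! m = i \<and> v = take (length v) (drop (Suc m) w)"
    by auto
  have "leading (Suc m) (if v = take (length v) (drop (Suc m) w) then c else 0)
      (act (weyl_op p \<alpha> \<beta> \<gamma>) (prod_list (map (detector p w) v)) g)"
    using Cons by (simp flip: m(1))
  from leading_detector[OF p m(2) this, of i] show ?case
    unfolding m_def[symmetric] split by (simp add: act_mult if_if_eq_conj)
qed

lemma PI_ring_cyclic_weyl_imp_root_of_unity: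
  fixes q \<alpha> \<beta> \<gamma> :: "'k::field"
  assumes "q \<noteq> 0" and "PI_ring (cyclic_weyl q \<alpha> \<beta> \<gamma>)"
  shows "\<exists>n\<ge>1. (q\<^sup>2) ^ n = 1"
proof (rule ccontr)
  define p where "p = q\<^sup>2"
  assume "\<not> ?thesis"
  then have p: "p \<noteq> 0" "\<And>n. n \<ge> 1 \<Longrightarrow> p ^ n \<noteq> 1"
    using assms(1) by (auto simp: p_def)
  let ?T = "weyl_op p \<alpha> \<beta> \<gamma>"
  interpret linear_operators ?T by (rule linear_operators_weyl_op)
  from assms(2) obtain f where monic: "nc_monic f"
    and f: "\<And>r. word_eval r f \<in> cyclic_weyl_ideal q \<alpha> \<beta> \<gamma>"
    unfolding cyclic_weyl_def PI_ring_quotient_iff[OF two_sided_ideal_cyclic_weyl] by blast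
  from monic obtain w0 where w0: "w0 \<in> Poly_Mapping.keys f" "Poly_Mapping.lookup f w0 = 1"
    "\<And>v. v \<in> Poly_Mapping.keys f \<Longrightarrow> length (letters v) \<le> length (letters w0)"
    unfolding nc_monic_def by blast
  define w where "w = letters w0"
  define d where "d = length w"
  \<comment> \<open>The unit vector whose leading coefficient sits exactly as many positions up as
    the longest words can descend.\<close>
  define g where "g = (\<lambda>(a :: nat, b). if a = 0 \<and> b = d then 1 else 0 :: 'k)"
  have g: "leading d 1 g" by (simp add: leading_def g_def)
  let ?J = "{a. \<forall>g. act ?T a g = (\<lambda>i. 0)}"
  have rels: "cyclic_weyl_rels q \<alpha> \<beta> \<gamma> \<subseteq> ?J"
    using p(1) unfolding cyclic_weyl_rels_def p_def[symmetric]
    by (auto simp: fun_eq_iff act_diff act_add act_mult act_scal act_gen[abs_def]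
        weyl_op_xy weyl_op_xz weyl_op_yz simp del: weyl_op.simps)
  have "cyclic_weyl_ideal q \<alpha> \<beta> \<gamma> \<subseteq> ?J"
    unfolding cyclic_weyl_ideal_def
    using annihilator_ideal rels
    by (intro ring.genideal_minimal ring_of_type_algebra_ring) (simp_all add: ideal_type_algebra_iff)
  then have "word_eval (detector p w) f \<in> ?J"
    using f by blast
  then have zero: "act ?T (word_eval (detector p w) f) g (0, 0) = 0"
    by simp
  have of_nat: "(of_nat n :: (xyz, 'k) free_algebra) = scal (of_nat n)" for n
    by (induction n) (simp_all add: scal_0 scal_1 scal_add)
  have of_int: "(of_int k :: (xyz, 'k) free_algebra) = scal (of_int k)" for k
    by (cases k rule: int_diff_cases) (simp add: of_nat scal_diff)
  \<comment> \<open>A word of length \<open>d\<close> lands in position 0 and is detected only if it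
    is \<open>w\<close>; after a shorter word, position 0 still lies below the leading
    position.\<close>
  have word_value: "act ?T (prod_list (map (detector p w) (letters v))) g (0, 0) = (if v = w0 then 1 else 0)"
    if "v \<in> Poly_Mapping.keys f" for v
  proof -
    have le: "length (letters v) \<le> d"
      using w0(3)[OF that] by (simp add: d_def w_def)
    have lead: "leading (d - length (letters v))
        (if letters v = take (length (letters v)) (drop (d - length (letters v)) w) then 1 else 0)
        (act ?T (prod_list (map (detector p w) (letters v))) g)"
      by (rule leading_detector_word[OF p g le]) (simp_all add: d_def)
    show ?thesis
    proof (cases "length (letters v) = d")
      case True
      then have "letters v = take (length (letters v)) (drop (d - length (letters v)) w) \<longleftrightarrow> v = w0"
        by (auto simp: d_def w_def free_mon.expand)
      with lead True show ?thesis by (simp add: leading_def)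
    next
      case False
      then show ?thesis using lead le by (auto simp: leading_def d_def w_def)
    qed
  qed
  have "act ?T (word_eval (detector p w) f) g (0, 0) =
      (\<Sum>v\<in>Poly_Mapping.keys f. if v = w0 then of_int (Poly_Mapping.lookup f v) else 0)"
    unfolding word_eval_def act_sum of_int by (intro sum.cong) (auto simp: act_scal_mult word_value)
  also have "\<dots> = 1" using w0 by simp
  finally show False using zero by simp
qed

theorem theorem3p2:
  fixes q \<alpha> \<beta> \<gamma> :: "'k::alg_closed_field"
  assumes "q \<noteq> 0" and "q\<^sup>2 \<noteq> 1"
  shows "PI_ring (cyclic_weyl q \<alpha> \<beta> \<gamma>) \<longleftrightarrow> (\<exists>n::nat. n \<ge> 1 \<and> (q\<^sup>2) ^ n = 1)"
proof
  assume "PI_ring (cyclic_weyl q \<alpha> \<beta> \<gamma>)"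
  then show "\<exists>n::nat. n \<ge> 1 \<and> (q\<^sup>2) ^ n = 1"
    using PI_ring_cyclic_weyl_imp_root_of_unity assms(1) by blast
next
  assume "\<exists>n::nat. n \<ge> 1 \<and> (q\<^sup>2) ^ n = 1"
  then obtain n :: nat where "n \<ge> 1" "(q\<^sup>2) ^ n = 1" by auto
  with assms show "PI_ring (cyclic_weyl q \<alpha> \<beta> \<gamma>)"
    by (rule PI_ring_cyclic_weyl_if_root_of_unity)
qed

end
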